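(* Let $d\ge 1$, let $\{X_{\mathbf n}:\mathbf n\in\mathbb Z^d\}$ be a stationary random field, let $\preccurlyeq$ be a translation invariant total order on $\mathbb Z^d$, let $\{v_n\}\subset\mathbb R$, and let $\{\mathbf N(n)\}\subset\mathbb N^d$ satisfy $N_l(n)\to\infty$ for every $l\in\{1,\dots,d\}$ and $N_1(n)N_2(n)\cdots N_d(n)\sim n^d$. Let $r_n\to\infty$, and call a sequence $\{k_n\}$ of positive integers admissible if $k_n\to\infty$, $k_n=o(r_n)$, and $\mathbf p(n):=(\lfloor N_1(n)/k_n\rfloor,\dots,\lfloor N_d(n)/k_n\rfloor)$ tends to infinity in every coordinate. Suppose that for every admissible $\{k_n\}$, with the corresponding $\mathbf p(n)$, $$\mathbb P\left(M_{\mathbf N(n)}\le v_n\right)=\mathbb P\left(M_{\mathbf p(n)}\le v_n\right)^{k_n^d}+o(1)\qquad (n\to\infty),$$ that $\liminf_{n\to\infty}\mathbb P\left(M_{\mathbf N(n)}\le v_n\right)>0$, and that $$0<\liminf_{n\to\infty}n^d\,\mathbb P(X_{\mathbf 0}>v_n)\le\limsup_{n\to\infty}n^d\,\mathbb P(X_{\mathbf 0}>v_n)<\infty.$$ Let $\{k_n\}$ be admissible, with the corresponding $\mathbf p(n)$, and let $\theta\in[0,1]$. Then $$\mathbb P\left(M_{\mathbf N(n)}\le v_n\right)-\mathbb P\left(X_{\mathbf 0}\le v_n\right)^{\theta n^d}\longrightarrow 0\qquad (n\to\infty)$$ if and only if $$\theta=\lim_{n\to\infty}\mathbb P\left(M_{A(\mathbf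 p(n))}\le v_n\,\middle|\,X_{\mathbf 0}>v_n\right).$$ If, moreover, for some $m\in\mathbb N$, $$n^d\,\mathbb P\left(X_{\mathbf 0}>v_n\ge M_{A((m,m,\dots,m))},\ M_{A(\mathbf p(n))\setminus A((m,m,\dots,m))}>v_n\right)\longrightarrow 0\qquad (n\to\infty),$$ then these conditions are equivalent to $$\theta=\lim_{n\to\infty}\mathbb P\left(M_{A((m,m,\dots,m))}\le v_n\,\middle|\,X_{\mathbf 0}>v_n\right).$$
   Context: Stationary means that the finite-dimensional distributions are invariant under all translations of $\mathbb Z^d$. $\mathbb N$ denotes the nonnegative integers. Inequalities $\mathbf i\le\mathbf j$ between elements of $\mathbb Z^d$ are coordinatewise; $\mathbf 0=(0,\dots,0)$, $\mathbf 1=(1,\dots,1)$. For finite $A\subset\mathbb Z^d$, $M_A:=\sup\{X_{\mathbf i}:\mathbf i\in A\}$ (with $\sup\emptyset=-\infty$), and for $\mathbf n\in\mathbb N^d$, $M_{\mathbf n}:=\sup\{X_{\mathbf i}:\mathbf 1\le\mathbf i\le\mathbf n\}$. A total order $\preccurlyeq$ on $\mathbb Z^d$ is translation invariant if $\mathbf i\preccurlyeq\mathbf j$ implies $\mathbf i+\mathbf k\preccurlyeq\mathbf j+\mathbf k$ for all $\mathbf k\in\mathbb Z^d$; $\mathbf i\prec\mathbf j$ means $\mathbf i\preccurlyeq\mathbf j$ and $\mathbf i\ne\mathbf j$. For $\mathbf p\in\mathbb N^d$, $$A(\mathbf p):=\{\mathbf j\in\mathbb Z^d:\ -\mathbf p\le\mathbf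 j\le\mathbf p\text{ and }\mathbf 0\prec\mathbf j\}.$$ A number $\theta=\lim$ of a sequence means that the limit exists and equals $\theta$. *)

theory Defs
  imports "HOL-Probability.Probability" "HOL-Library.Landau_Symbols"
begin

text \<open>The lattice \<open>\<int>\<^sup>d\<close> is the type \<^typ>\<open>int ^ 'd\<close> with \<open>'d\<close> an arbitrary finite (hence nonempty)
  index type, so that \<open>d = CARD('d) \<ge> 1\<close>; \<open>\<nat>\<^sup>d\<close> is \<^typ>\<open>nat ^ 'd\<close>.\<close>

definition stationary_field :: "'a measure \<Rightarrow> (int ^ 'd::finite \<Rightarrow> 'a \<Rightarrow> real) \<Rightarrow> bool" where
  "stationary_field M X \<longleftrightarrow>
     (\<forall>I k. finite I \<longrightarrow>
        distr M (Pi\<^sub>M I (\<lambda>_. borel)) (\<lambda>\<omega>. \<lambda>i\<in>I. X (i + k) \<omega>) =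
        distr M (Pi\<^sub>M I (\<lambda>_. borel)) (\<lambda>\<omega>. \<lambda>i\<in>I. X i \<omega>))"

definition transl_inv_total_order :: "((int ^ 'd::finite) \<times> (int ^ 'd)) set \<Rightarrow> bool" where
  "transl_inv_total_order R \<longleftrightarrow>
     linear_order R \<and> (\<forall>i j k. (i, j) \<in> R \<longrightarrow> (i + k, j + k) \<in> R)"

text \<open>The maximum is taken in \<^typ>\<open>ereal\<close>, where the supremum of the empty set is \<open>-\<infinity>\<close>.\<close>

definition field_max :: "(int ^ 'd::finite \<Rightarrow> 'a \<Rightarrow> real) \<Rightarrow> (int ^ 'd) set \<Rightarrow> 'a \<Rightarrow> ereal" where
  "field_max X A \<omega> = (SUP i\<in>A. ereal (X i \<omega>))"

definition lattice_box :: "nat ^ 'd::finite \<Rightarrow> (int ^ 'd) set" where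
  "lattice_box n = {i. \<forall>l. 1 \<le> i $ l \<and> i $ l \<le> int (n $ l)}"

definition pos_box :: "((int ^ 'd::finite) \<times> (int ^ 'd)) set \<Rightarrow> nat ^ 'd \<Rightarrow> (int ^ 'd) set" where
  "pos_box R p =
     {j. (\<forall>l. - int (p $ l) \<le> j $ l \<and> j $ l \<le> int (p $ l)) \<and> (0, j) \<in> R \<and> j \<noteq> 0}"

definition block_size :: "(nat \<Rightarrow> nat ^ 'd::finite) \<Rightarrow> (nat \<Rightarrow> nat) \<Rightarrow> nat \<Rightarrow> nat ^ 'd" where
  "block_size N k n = (\<chi> l. N n $ l div k n)"

definition admissible ::
    "(nat \<Rightarrow> nat ^ 'd::finite) \<Rightarrow> (nat \<Rightarrow> real) \<Rightarrow> (nat \<Rightarrow> nat) \<Rightarrow> bool" where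
  "admissible N r k \<longleftrightarrow>
     (\<forall>n. 0 < k n) \<and>
     filterlim k at_top sequentially \<and>
     (\<lambda>n. real (k n)) \<in> o[sequentially](r) \<and>
     (\<forall>l. filterlim (\<lambda>n. block_size N k n $ l) at_top sequentially)"

end

(* Write a(n) = P(X_0 > v_n), t(n) = n^d a(n) and q(n) = P(M_{A(p(n))} <= v_n | X_0 > v_n).
   Decomposing the event that a block has an exceedance according to the last exceedance site
   in the given order shows P(M_{N(n)} <= v_n) = exp(-t(n) q(n)) + o(1).  Since t(n) is bounded
   above and away from 0, comparison with exp(-t(n) theta) is then equivalent to q(n) --> theta. *)

theory Submission
  imports Defs "HOL-Library.Discrete_Functions"
begin

text \<open>The obstacle is that the window A(p(n)) is as wide as the block p(n): translated to a
  site of that block, it reaches outside. Counting last exceedances in the block therefore yields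
  only one inequality, namely that the exceedance probability of the block is at least its volume
  times a(n) q(n). The reverse inequality needs blocks for which only a vanishing fraction of sites
  has a window leaving the block. This is affordable because P(M_{N(n)} <= v_n) does not depend on
  k_n, and the factorization into blocks is assumed for every admissible sequence: one inequality
  may use k_n, the other a slower sequence k'_n with k'_n / k_n --> 0, while q(n) stays tied to k_n.
  For either sequence the exponential enters in the same way: if e is the exceedance probability of
  one block and K the number of blocks, then K e stays bounded by the union bound, so (1 - e)^K and
  exp(-K e) differ by at most a multiple of 1/K.\<close>

section \<open>Maxima and coordinate boxes\<close>

lemma field_max_le_iff: "field_max X A \<omega> \<le> ereal c \<longleftrightarrow> (\<forall>i\<in>A. X i \<omega> \<le> c)"
  by (simp add: field_max_def SUP_le_iff)

lemma field_max_gt_iff: "ereal c < field_max X A \<omega> \<longleftrightarrow> (\<exists>i\<in>A. c < X i \<omega>)"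
  by (simp add: field_max_def less_SUP_iff)

text \<open>Moves a product set of vectors to the extensional function space, where
  \<open>card_PiE\<close> and \<open>finite_PiE\<close> apply.\<close>

lemma vec_rect_eq_image:
  "{i :: 'b ^ 'd::finite. \<forall>l. i $ l \<in> S l} = vec_lambda ` (Pi\<^sub>E UNIV S)"
proof (intro equalityI subsetI)
  fix i :: "'b ^ 'd" assume "i \<in> {i. \<forall>l. i $ l \<in> S l}"
  then have "(\<lambda>l. i $ l) \<in> Pi\<^sub>E UNIV S" by auto
  moreover have "i = vec_lambda (\<lambda>l. i $ l)" by simp
  ultimately show "i \<in> vec_lambda ` (Pi\<^sub>E UNIV S)" by blast
qed (auto simp: PiE_def Pi_def)

lemma card_vec_rect:
  "card {i :: 'b ^ 'd::finite. \<forall>l. i $ l \<in> S l} = (\<Prod>l\<in>UNIV. card (S l))"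
proof -
  have "inj_on (vec_lambda :: ('d \<Rightarrow> 'b) \<Rightarrow> 'b ^ 'd) (Pi\<^sub>E UNIV S)"
    by (auto intro!: inj_onI simp: vec_lambda_inject)
  then show ?thesis
    by (simp add: vec_rect_eq_image card_image card_PiE)
qed

lemma finite_vec_rect:
  assumes "\<And>l. finite (S l)"
  shows "finite {i :: 'b ^ 'd::finite. \<forall>l. i $ l \<in> S l}"
  by (simp add: vec_rect_eq_image assms finite_PiE)

lemma lattice_box_eq_rect: "lattice_box p = {i. \<forall>l. i $ l \<in> {1..int (p $ l)}}"
  by (auto simp: lattice_box_def)

lemma finite_lattice_box: "finite (lattice_box p)"
  unfolding lattice_box_eq_rect by (rule finite_vec_rect) simp

lemma card_lattice_box: "card (lattice_box p) = (\<Prod>l\<in>UNIV. p $ l)"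
  unfolding lattice_box_eq_rect by (subst card_vec_rect) simp

lemma finite_pos_box: "finite (pos_box R p)"
proof (rule finite_subset)
  show "pos_box R p \<subseteq> {i. \<forall>l. i $ l \<in> {- int (p $ l)..int (p $ l)}}"
    by (auto simp: pos_box_def)
  show "finite {i :: int ^ 'a. \<forall>l. i $ l \<in> {- int (p $ l)..int (p $ l)}}"
    by (rule finite_vec_rect) simp
qed

section \<open>Last exceedances and stationarity\<close>

text \<open>Supplies the last exceedance site. In the induction a new element either lies above the
  old maximal one and replaces it, or leaves it maximal.\<close>

lemma linear_order_finite_maximal:
  assumes "linear_order R" "finite A" "A \<noteq> {}"
  shows "\<exists>m\<in>A. \<forall>j\<in>A. (m, j) \<in> R \<longrightarrow> j = m"
  using assms(2,3)
proof (induction rule: finite_ne_induct)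
  case (insert x F)
  have tr: "\<And>a b c. (a, b) \<in> R \<Longrightarrow> (b, c) \<in> R \<Longrightarrow> (a, c) \<in> R"
    and an: "\<And>a b. (a, b) \<in> R \<Longrightarrow> (b, a) \<in> R \<Longrightarrow> a = b"
    using assms(1) unfolding order_on_defs by (blast dest: transD antisymD)+
  from insert obtain m where m: "m \<in> F" "\<forall>j\<in>F. (m, j) \<in> R \<longrightarrow> j = m" by auto
  show ?case
  proof (cases "(m, x) \<in> R")
    case True
    have "\<forall>j\<in>insert x F. (x, j) \<in> R \<longrightarrow> j = x"
      using m True tr an by (metis insert_iff)
    then show ?thesis by blast
  next
    case False
    then show ?thesis using m by blast
  qed
qed simp

text \<open>Both events are preimages of one measurable set \<open>S\<close> of configurations on a
  finite index set, and stationarity equates the two laws on that set.\<close>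

lemma stationary_field_prob_shift:
  fixes X :: "int ^ 'd::finite \<Rightarrow> 'a \<Rightarrow> real"
  assumes meas: "\<And>i. X i \<in> borel_measurable M"
    and stat: "stationary_field M X" and "finite B"
  shows "\<P>(\<omega> in M. X i \<omega> > c \<and> (\<forall>j\<in>B. X (j + i) \<omega> \<le> c))
       = \<P>(\<omega> in M. X 0 \<omega> > c \<and> (\<forall>j\<in>B. X j \<omega> \<le> c))"
proof -
  \<comment> \<open>The origin is added because the exceedance there is part of the event even when
    \<open>B\<close> does not contain it; this also makes the case \<open>B = {}\<close>
    meaningful.\<close>
  define I where "I = insert 0 B"
  have fI: "finite I" using assms(3) by (simp add: I_def)
  let ?P = "Pi\<^sub>M I (\<lambda>_. borel) :: (int ^ 'd \<Rightarrow> real) measure"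
  define S where "S = {f \<in> space ?P. f 0 > c \<and> (\<forall>j\<in>B. f j \<le> c)}"
  have [measurable]: "(\<lambda>f. f j) \<in> borel_measurable ?P" if "j \<in> I" for j
    using that by measurable
  have m1: "{f \<in> space ?P. f 0 > c} \<in> sets ?P"
    by (rule borel_measurable_less) (auto simp: I_def)
  have m2: "{f \<in> space ?P. \<forall>j\<in>B. f j \<le> c} \<in> sets ?P"
    by (rule sets.sets_Collect_finite_All[OF _ assms(3)], rule borel_measurable_le)
       (auto simp: I_def)
  have S: "S \<in> sets ?P"
  proof -
    have "S = {f \<in> space ?P. f 0 > c} \<inter> {f \<in> space ?P. \<forall>j\<in>B. f j \<le> c}"
      by (auto simp: S_def)
    then show ?thesis using m1 m2 by simp
  qed
  have fm: "(\<lambda>\<omega>. \<lambda>j\<in>I. X (j + k) \<omega>) \<in> measurable M ?P" for k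
    by (rule measurable_restrict) (use meas in auto)
  have *: "measure (distr M ?P (\<lambda>\<omega>. \<lambda>j\<in>I. X (j + k) \<omega>)) S
      = \<P>(\<omega> in M. X k \<omega> > c \<and> (\<forall>j\<in>B. X (j + k) \<omega> \<le> c))" for k
  proof -
    have "(\<lambda>\<omega>. \<lambda>j\<in>I. X (j + k) \<omega>) -` S \<inter> space M
        = {\<omega> \<in> space M. X k \<omega> > c \<and> (\<forall>j\<in>B. X (j + k) \<omega> \<le> c)}"
      using measurable_space[OF fm[of k]] by (auto simp: S_def I_def)
    then show ?thesis by (subst measure_distr[OF fm S]) simp
  qed
  have "distr M ?P (\<lambda>\<omega>. \<lambda>j\<in>I. X (j + i) \<omega>) = distr M ?P (\<lambda>\<omega>. \<lambda>j\<in>I. X (j + 0) \<omega>)"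
    using stat fI unfolding stationary_field_def by simp
  then show ?thesis using *[of i] *[of 0] by simp
qed

text \<open>Every configuration with an exceedance in \<open>B\<close> has exactly one exceedance site that is last
  with respect to the order.\<close>

lemma prob_exceedance_eq_sum_last:
  fixes X :: "'i \<Rightarrow> 'a \<Rightarrow> real"
  assumes "prob_space M" and meas: "\<And>i. X i \<in> borel_measurable M"
    and R: "linear_order R" and fin: "finite B"
  shows "\<P>(\<omega> in M. \<exists>i\<in>B. X i \<omega> > c)
       = (\<Sum>i\<in>B. \<P>(\<omega> in M. X i \<omega> > c \<and> (\<forall>j\<in>B. (i, j) \<in> R \<and> j \<noteq> i \<longrightarrow> X j \<omega> \<le> c)))"
proof -
  interpret prob_space M by fact
  note meas[measurable]
  define E where
    "E i = {\<omega> \<in> space M. X i \<omega> > c \<and> (\<forall>j\<in>B. (i, j) \<in> R \<and> j \<noteq> i \<longrightarrow> X j \<omega> \<le> c)}" for i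
  have tot: "\<And>a b. (a, b) \<in> R \<or> (b, a) \<in> R"
    using R unfolding order_on_defs total_on_def refl_on_def by (metis UNIV_I)
  have E: "E i \<in> events" for i
  proof -
    have "E i = {\<omega> \<in> space M. X i \<omega> > c} \<inter>
      {\<omega> \<in> space M. \<forall>j\<in>{j\<in>B. (i, j) \<in> R \<and> j \<noteq> i}. X j \<omega> \<le> c}"
      by (auto simp: E_def)
    also have "\<dots> \<in> events"
      using fin by (intro sets.Int sets.sets_Collect_finite_All) auto
    finally show ?thesis .
  qed
  have "{\<omega> \<in> space M. \<exists>i\<in>B. X i \<omega> > c} = (\<Union>i\<in>B. E i)"
  proof (intro equalityI subsetI)
    fix \<omega> assume w: "\<omega> \<in> {\<omega> \<in> space M. \<exists>i\<in>B. X i \<omega> > c}"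
    then have "{i\<in>B. X i \<omega> > c} \<noteq> {}" "finite {i\<in>B. X i \<omega> > c}" using fin by auto
    from linear_order_finite_maximal[OF R this(2,1)]
    obtain m where "m \<in> B" "X m \<omega> > c" "\<forall>j\<in>{i\<in>B. X i \<omega> > c}. (m, j) \<in> R \<longrightarrow> j = m" by auto
    then have "\<omega> \<in> E m" using w by (force simp: E_def not_less[symmetric])
    then show "\<omega> \<in> (\<Union>i\<in>B. E i)" using \<open>m \<in> B\<close> by blast
  qed (auto simp: E_def)
  moreover have "disjoint_family_on E B"
    unfolding disjoint_family_on_def
  proof (intro ballI impI)
    fix i j assume "i \<in> B" "j \<in> B" "i \<noteq> j"
    \<comment> \<open>Of two distinct sites one precedes the other, and the event of the earlier one
      forbids an exceedance at the later one.\<close>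
    then show "E i \<inter> E j = {}" using tot[of i j] by (force simp: E_def)
  qed
  ultimately show ?thesis
    using finite_measure_finite_Union[OF fin, of E] E by (auto simp: E_def[symmetric])
qed

lemma transl_inv_diff:
  assumes "transl_inv_total_order R" "(i, j) \<in> R"
  shows "(0, j - i) \<in> R"
  using assms unfolding transl_inv_total_order_def
  by (metis add.right_inverse diff_conv_add_uminus)

lemma transl_inv_add:
  assumes "transl_inv_total_order R" "(0, j) \<in> R"
  shows "(i, j + i) \<in> R"
  using assms unfolding transl_inv_total_order_def by (metis add_0)

section \<open>Exceedance probabilities of a stationary field on boxes\<close>

context
  fixes M :: "'a measure" and X :: "int ^ 'd::finite \<Rightarrow> 'a \<Rightarrow> real"
    and R :: "((int ^ 'd) \<times> (int ^ 'd)) set"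
  assumes ps: "prob_space M" and meas: "\<And>i. X i \<in> borel_measurable M"
    and stat: "stationary_field M X" and ord: "transl_inv_total_order R"
begin

interpretation prob_space M by (rule ps)

lemma exceed_event: "{\<omega> \<in> space M. X i \<omega> > c} \<in> events"
  using meas by measurable

lemma finite_max_events:
  assumes "finite A"
  shows "{\<omega> \<in> space M. \<forall>j\<in>A. X j \<omega> \<le> c} \<in> events"
    and "{\<omega> \<in> space M. \<exists>j\<in>A. X j \<omega> > c} \<in> events"
  using meas assms
  by (auto intro!: sets.sets_Collect_finite_All sets.sets_Collect_finite_Ex)

lemma exceed_then_below_event:
  assumes "finite A"
  shows "{\<omega> \<in> space M. X i \<omega> > c \<and> (\<forall>j\<in>A. X (f j) \<omega> \<le> c)} \<in> events"
proof -
  have "{\<omega> \<in> space M. X i \<omega> > c \<and> (\<forall>j\<in>A. X (f j) \<omega> \<le> c)} =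
    {\<omega> \<in> space M. X i \<omega> > c} \<inter> {\<omega> \<in> space M. \<forall>j\<in>f ` A. X j \<omega> \<le> c}" by auto
  then show ?thesis using exceed_event finite_max_events(1)[of "f ` A"] assms by simp
qed

lemma prob_exceed_shift: "\<P>(\<omega> in M. X i \<omega> > c) = \<P>(\<omega> in M. X 0 \<omega> > c)"
  using stationary_field_prob_shift[OF meas stat, of "{}" c i] by simp

text \<open>Two sites of the box differ by less than \<open>p\<close> in each coordinate, so all
  later sites of the box, seen from \<open>i\<close>, lie in the window. Requiring the whole window
  to stay below \<open>c\<close> is thus stronger than \<open>i\<close> being the last exceedance,
  and no boundary term arises in this direction.\<close>

lemma prob_exceedance_ge:
  "real (\<Prod>l\<in>UNIV. p $ l) * \<P>(\<omega> in M. X 0 \<omega> > c \<and> (\<forall>j\<in>pos_box R p. X j \<omega> \<le> c))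
     \<le> \<P>(\<omega> in M. \<exists>i\<in>lattice_box p. X i \<omega> > c)"
proof -
  let ?B = "lattice_box p"
  have lin: "linear_order R" using ord by (simp add: transl_inv_total_order_def)
  have "\<P>(\<omega> in M. X 0 \<omega> > c \<and> (\<forall>j\<in>pos_box R p. X j \<omega> \<le> c))
      \<le> \<P>(\<omega> in M. X i \<omega> > c \<and> (\<forall>j\<in>?B. (i, j) \<in> R \<and> j \<noteq> i \<longrightarrow> X j \<omega> \<le> c))"
    if i: "i \<in> ?B" for i
  proof -
    have in_box: "j - i \<in> pos_box R p" if "j \<in> ?B" "(i, j) \<in> R" "j \<noteq> i" for j
    proof -
      have "- int (p $ l) \<le> (j - i) $ l \<and> (j - i) $ l \<le> int (p $ l)" for l
        using i that(1) by (simp add: lattice_box_def) (smt (verit))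
      then show ?thesis
        using transl_inv_diff[OF ord that(2)] that(3) by (simp add: pos_box_def)
    qed
    have "\<P>(\<omega> in M. X 0 \<omega> > c \<and> (\<forall>j\<in>pos_box R p. X j \<omega> \<le> c))
        = \<P>(\<omega> in M. X i \<omega> > c \<and> (\<forall>j\<in>pos_box R p. X (j + i) \<omega> \<le> c))"
      using stationary_field_prob_shift[OF meas stat finite_pos_box] by metis
    also have "\<dots> \<le> \<P>(\<omega> in M. X i \<omega> > c \<and> (\<forall>j\<in>{j\<in>?B. (i, j) \<in> R \<and> j \<noteq> i}. X j \<omega> \<le> c))"
    proof (rule finite_measure_mono)
      show "{\<omega> \<in> space M. X i \<omega> > c \<and> (\<forall>j\<in>{j\<in>?B. (i, j) \<in> R \<and> j \<noteq> i}. X j \<omega> \<le> c)} \<in> events"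
        by (rule exceed_then_below_event) (simp add: finite_lattice_box)
      have "X j \<omega> \<le> c"
        if "\<forall>j\<in>pos_box R p. X (j + i) \<omega> \<le> c" "j \<in> ?B" "(i, j) \<in> R" "j \<noteq> i" for j \<omega>
        using bspec[OF that(1) in_box[OF that(2-4)]] by simp
      then show "{\<omega> \<in> space M. X i \<omega> > c \<and> (\<forall>j\<in>pos_box R p. X (j + i) \<omega> \<le> c)}
          \<subseteq> {\<omega> \<in> space M. X i \<omega> > c \<and> (\<forall>j\<in>{j\<in>?B. (i, j) \<in> R \<and> j \<noteq> i}. X j \<omega> \<le> c)}"
        by blast
    qed
    finally show ?thesis by (simp add: Ball_def imp_conjL)
  qed
  then have "real (card ?B) * \<P>(\<omega> in M. X 0 \<omega> > c \<and> (\<forall>j\<in>pos_box R p. X j \<omega> \<le> c))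
    \<le> (\<Sum>i\<in>?B. \<P>(\<omega> in M. X i \<omega> > c \<and> (\<forall>j\<in>?B. (i, j) \<in> R \<and> j \<noteq> i \<longrightarrow> X j \<omega> \<le> c)))"
    by (intro sum_bounded_below)
  then show ?thesis
    unfolding prob_exceedance_eq_sum_last[OF ps meas lin finite_lattice_box] card_lattice_box .
qed

text \<open>For the sites of the large box \<open>p'\<close> at distance at least \<open>p\<close> from its boundary, the window
  \<open>pos_box R p\<close> stays inside the box; the remaining sites are estimated trivially.\<close>

lemma prob_exceedance_le:
  assumes le: "\<And>l. p $ l \<le> p' $ l"
  shows "\<P>(\<omega> in M. \<exists>i\<in>lattice_box p'. X i \<omega> > c)
     \<le> real (\<Prod>l\<in>UNIV. p' $ l) * \<P>(\<omega> in M. X 0 \<omega> > c \<and> (\<forall>j\<in>pos_box R p. X j \<omega> \<le> c))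
       + (real (\<Prod>l\<in>UNIV. p' $ l) - real (\<Prod>l\<in>UNIV. p' $ l - 2 * p $ l)) * \<P>(\<omega> in M. X 0 \<omega> > c)"
proof -
  let ?B = "lattice_box p'" and ?g = "\<P>(\<omega> in M. X 0 \<omega> > c \<and> (\<forall>j\<in>pos_box R p. X j \<omega> \<le> c))"
  let ?a = "\<P>(\<omega> in M. X 0 \<omega> > c)"
  \<comment> \<open>The margins are chosen so that adding a vector with coordinates between
    \<open>-p\<close> and \<open>p\<close> keeps the site between \<open>1\<close> and
    \<open>p'\<close>.\<close>
  define J where "J = {i :: int ^ 'd. \<forall>l. i $ l \<in> {int (p $ l) + 1 .. int (p' $ l) - int (p $ l)}}"
  define T where "T i = \<P>(\<omega> in M. X i \<omega> > c \<and> (\<forall>j\<in>?B. (i, j) \<in> R \<and> j \<noteq> i \<longrightarrow> X j \<omega> \<le> c))" for i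
  have lin: "linear_order R" using ord by (simp add: transl_inv_total_order_def)
  \<comment> \<open>If \<open>2 * p\<close> exceeds \<open>p'\<close> in some coordinate, the
    interval is empty and the truncated subtraction correctly gives 0.\<close>
  have cJ: "card J = (\<Prod>l\<in>UNIV. p' $ l - 2 * p $ l)"
    unfolding J_def by (subst card_vec_rect) (auto intro!: prod.cong)
  have JB: "J \<subseteq> ?B"
  proof
    fix i assume "i \<in> J"
    then have "int (p $ l) + 1 \<le> i $ l \<and> i $ l \<le> int (p' $ l) - int (p $ l)" for l
      by (simp add: J_def)
    then show "i \<in> ?B" by (simp add: lattice_box_def) (smt (verit) of_nat_0_le_iff)
  qed
  have fJ: "finite J" using JB finite_lattice_box finite_subset by blast
  have T1: "T i \<le> ?g" if i: "i \<in> J" for i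
  proof -
    have in_box: "j + i \<in> ?B \<and> (i, j + i) \<in> R \<and> j + i \<noteq> i" if j: "j \<in> pos_box R p" for j
    proof -
      have "1 \<le> (j + i) $ l \<and> (j + i) $ l \<le> int (p' $ l)" for l
        using i j by (simp add: J_def pos_box_def) (smt (verit))
      then show ?thesis using j transl_inv_add[OF ord]
        by (simp add: pos_box_def lattice_box_def)
    qed
    have "T i \<le> \<P>(\<omega> in M. X i \<omega> > c \<and> (\<forall>j\<in>pos_box R p. X (j + i) \<omega> \<le> c))"
      unfolding T_def
    proof (rule finite_measure_mono)
      show "{\<omega> \<in> space M. X i \<omega> > c \<and> (\<forall>j\<in>pos_box R p. X (j + i) \<omega> \<le> c)} \<in> events"
        by (rule exceed_then_below_event) (rule finite_pos_box)
    qed (use in_box in auto)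
    also have "\<dots> = ?g" by (rule stationary_field_prob_shift[OF meas stat finite_pos_box])
    finally show ?thesis .
  qed
  have T2: "T i \<le> ?a" for i
  proof -
    have "T i \<le> \<P>(\<omega> in M. X i \<omega> > c)"
      unfolding T_def by (rule finite_measure_mono[OF _ exceed_event]) auto
    also have "\<dots> = ?a" by (rule prob_exceed_shift)
    finally show ?thesis .
  qed
  have "(\<Sum>i\<in>?B. T i) = (\<Sum>i\<in>J. T i) + (\<Sum>i\<in>?B - J. T i)"
    using sum.subset_diff[OF JB finite_lattice_box] by (simp add: add.commute)
  also have "(\<Sum>i\<in>J. T i) \<le> real (card J) * ?g" by (rule sum_bounded_above) (rule T1)
  also have "(\<Sum>i\<in>?B - J. T i) \<le> real (card (?B - J)) * ?a" by (rule sum_bounded_above) (rule T2)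
  also have "real (card (?B - J)) = real (card ?B) - real (card J)"
    using JB fJ card_mono[OF finite_lattice_box JB] by (simp add: card_Diff_subset of_nat_diff)
  also have "real (card J) * ?g \<le> real (card ?B) * ?g"
    by (intro mult_right_mono) (auto intro!: card_mono JB finite_lattice_box)
  finally have "(\<Sum>i\<in>?B. T i) \<le> real (card ?B) * ?g + (real (card ?B) - real (card J)) * ?a"
    by simp
  then show ?thesis
    unfolding T_def card_lattice_box cJ prob_exceedance_eq_sum_last[OF ps meas lin finite_lattice_box] .
qed

text \<open>Union bound. It keeps the number of blocks times the exceedance probability of one block
  bounded, which replacing a power by an exponential requires.\<close>

lemma prob_exceedance_le_card:
  "\<P>(\<omega> in M. \<exists>i\<in>lattice_box p. X i \<omega> > c) \<le> real (\<Prod>l\<in>UNIV. p $ l) * \<P>(\<omega> in M. X 0 \<omega> > c)"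
proof -
  have "{\<omega> \<in> space M. \<exists>i\<in>lattice_box p. X i \<omega> > c}
      = (\<Union>i\<in>lattice_box p. {\<omega> \<in> space M. X i \<omega> > c})" by auto
  then have "\<P>(\<omega> in M. \<exists>i\<in>lattice_box p. X i \<omega> > c)
      \<le> (\<Sum>i\<in>lattice_box p. \<P>(\<omega> in M. X i \<omega> > c))"
    using exceed_event finite_lattice_box
    by (auto intro!: finite_measure_subadditive_finite)
  also have "\<dots> = (\<Sum>i\<in>lattice_box p. \<P>(\<omega> in M. X 0 \<omega> > c))"
    by (intro sum.cong refl prob_exceed_shift)
  finally show ?thesis by (simp add: card_lattice_box)
qed

lemma prob_field_max_le_eq:
  assumes "finite A"
  shows "\<P>(\<omega> in M. field_max X A \<omega> \<le> ereal c) = 1 - \<P>(\<omega> in M. \<exists>i\<in>A. X i \<omega> > c)"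
proof -
  have "{\<omega> \<in> space M. field_max X A \<omega> \<le> ereal c} = space M - {\<omega> \<in> space M. \<exists>i\<in>A. X i \<omega> > c}"
    by (auto simp: field_max_le_iff not_less)
  then show ?thesis using prob_compl finite_max_events(2)[OF assms] by simp
qed

lemma prob_below_eq: "\<P>(\<omega> in M. X 0 \<omega> \<le> c) = 1 - \<P>(\<omega> in M. X 0 \<omega> > c)"
proof -
  have "{\<omega> \<in> space M. X 0 \<omega> \<le> c} = space M - {\<omega> \<in> space M. X 0 \<omega> > c}" by auto
  then show ?thesis using prob_compl exceed_event by simp
qed

text \<open>The product form holds even if \<open>X 0\<close> exceeds \<open>c\<close> with
  probability 0: the conditional probability is then a division by zero with value 0, and the joint
  probability vanishes too. Later arguments can thus avoid dividing by the exceedance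
  probability.\<close>

lemma cond_prob_times_exceed:
  assumes "finite A"
  shows "\<P>(\<omega> in M. X 0 \<omega> > c) * \<P>(\<omega> in M. field_max X A \<omega> \<le> ereal c \<bar> X 0 \<omega> > c)
       = \<P>(\<omega> in M. X 0 \<omega> > c \<and> (\<forall>j\<in>A. X j \<omega> \<le> c))"
    and "\<P>(\<omega> in M. field_max X A \<omega> \<le> ereal c \<bar> X 0 \<omega> > c) \<in> {0..1}"
proof -
  let ?g = "\<P>(\<omega> in M. X 0 \<omega> > c \<and> (\<forall>j\<in>A. X j \<omega> \<le> c))" and ?a = "\<P>(\<omega> in M. X 0 \<omega> > c)"
  have le: "?g \<le> ?a" by (rule finite_measure_mono[OF _ exceed_event]) auto
  have q: "\<P>(\<omega> in M. field_max X A \<omega> \<le> ereal c \<bar> X 0 \<omega> > c) = ?g / ?a"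
    by (simp add: cond_prob_def field_max_le_iff conj_commute)
  show "?a * \<P>(\<omega> in M. field_max X A \<omega> \<le> ereal c \<bar> X 0 \<omega> > c) = ?g"
    unfolding q using le measure_nonneg[of M] by (cases "?a = 0") (auto intro: antisym)
  show "\<P>(\<omega> in M. field_max X A \<omega> \<le> ereal c \<bar> X 0 \<omega> > c) \<in> {0..1}"
    unfolding q using le by (simp add: divide_le_eq_1 zero_less_measure_iff)
qed

text \<open>The event of the additional condition in the theorem is the difference of two nested
  window events, which turns that condition into a statement about two conditional
  probabilities.\<close>

lemma prob_below_diff:
  assumes "finite A" "finite B" "B \<subseteq> A"
  shows "\<P>(\<omega> in M. X 0 \<omega> > c \<and> c \<ge> field_max X B \<omega> \<and> field_max X (A - B) \<omega> > c)
    = \<P>(\<omega> in M. X 0 \<omega> > c \<and> (\<forall>j\<in>B. X j \<omega> \<le> c)) - \<P>(\<omega> in M. X 0 \<omega> > c \<and> (\<forall>j\<in>A. X j \<omega> \<le> c))"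
proof -
  have "{\<omega> \<in> space M. X 0 \<omega> > c \<and> c \<ge> field_max X B \<omega> \<and> field_max X (A - B) \<omega> > c}
    = {\<omega> \<in> space M. X 0 \<omega> > c \<and> (\<forall>j\<in>B. X j \<omega> \<le> c)} - {\<omega> \<in> space M. X 0 \<omega> > c \<and> (\<forall>j\<in>A. X j \<omega> \<le> c)}"
    using assms(3) by (force simp: field_max_le_iff field_max_gt_iff not_le)
  moreover have "{\<omega> \<in> space M. X 0 \<omega> > c \<and> (\<forall>j\<in>A. X j \<omega> \<le> c)}
      \<subseteq> {\<omega> \<in> space M. X 0 \<omega> > c \<and> (\<forall>j\<in>B. X j \<omega> \<le> c)}"
    using assms(3) by auto
  ultimately show ?thesis
    using exceed_then_below_event[OF assms(1), where f = "\<lambda>j. j"]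
      exceed_then_below_event[OF assms(2), where f = "\<lambda>j. j"]
    by (simp add: finite_measure_Diff)
qed

end

section \<open>Elementary estimates for exponentials and powers\<close>

lemma abs_exp_diff_le:
  fixes s t :: real
  assumes "s \<le> 0" "t \<le> 0"
  shows "\<bar>exp s - exp t\<bar> \<le> \<bar>s - t\<bar>"
proof -
  have *: "exp t - exp s \<le> t - s \<and> exp s \<le> exp t" if "s \<le> t" "t \<le> 0" for s t :: real
  proof -
    have "exp t - exp s = exp t * (1 - exp (s - t))" by (simp add: algebra_simps flip: exp_add)
    also have "\<dots> \<le> 1 * (t - s)"
    proof (rule mult_mono)
      show "1 - exp (s - t) \<le> t - s" using exp_ge_add_one_self[of "s - t"] by linarith
    qed (use that in auto)
    finally show ?thesis using that by simp
  qed
  show ?thesis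
    using *[of s t] *[of t s] assms by (cases "s \<le> t") auto
qed

text \<open>The slope of exp is at least \<open>exp (- C)\<close> to the right of
  \<open>- C\<close>. This reverse Lipschitz bound allows convergence of exponentials to be read
  back as convergence of exponents.\<close>

lemma abs_exp_diff_ge:
  fixes s t :: real
  assumes "- C \<le> s" "- C \<le> t"
  shows "exp (- C) * \<bar>s - t\<bar> \<le> \<bar>exp s - exp t\<bar>"
proof -
  have *: "exp (- C) * (t - s) \<le> exp t - exp s" if "s \<le> t" "- C \<le> s" for s t :: real
  proof -
    have "exp (- C) * (t - s) \<le> exp s * (t - s)" using that by (intro mult_right_mono) auto
    also have "\<dots> \<le> exp s * (exp (t - s) - 1)"
    proof (rule mult_left_mono)
      show "t - s \<le> exp (t - s) - 1" using exp_ge_add_one_self[of "t - s"] by linarith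
    qed simp
    also have "\<dots> = exp t - exp s" by (simp add: algebra_simps flip: exp_add)
    finally show ?thesis .
  qed
  show ?thesis using *[of s t] *[of t s] assms by (cases "s \<le> t") auto
qed

text \<open>The bases \<open>1 - x\<close> and \<open>exp (- x)\<close> differ by at most
  \<open>x\<^sup>2\<close>, and m-th powers of numbers in the unit interval differ by at most
  \<open>m\<close> times the difference of the bases.\<close>

lemma abs_power_minus_exp_le:
  fixes x :: real
  assumes "0 \<le> x" "x \<le> 1"
  shows "\<bar>(1 - x) ^ m - exp (- (real m * x))\<bar> \<le> real m * x\<^sup>2"
proof -
  have "exp (- x) \<le> 1 - x + x\<^sup>2"
  proof -
    have "exp (- x) \<le> 1 / (1 + x)"
      using exp_ge_add_one_self[of x] assms by (simp add: exp_minus divide_simps)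
    \<comment> \<open>The product on the right equals 1 + x^3.\<close>
    also have "1 \<le> (1 - x + x\<^sup>2) * (1 + x)"
      using assms by (simp add: algebra_simps power2_eq_square)
    then have "1 / (1 + x) \<le> 1 - x + x\<^sup>2" using assms by (simp add: divide_le_eq)
    finally show ?thesis .
  qed
  then have *: "\<bar>(1 - x) - exp (- x)\<bar> \<le> x\<^sup>2" using exp_ge_add_one_self[of "- x"] by auto
  have "norm ((1 - x) ^ m - exp (- x) ^ m) \<le> real m * norm ((1 - x) - exp (- x))"
    using assms by (intro norm_power_diff) auto
  also have "\<dots> \<le> real m * x\<^sup>2" using * by (intro mult_left_mono) auto
  finally show ?thesis by (simp flip: exp_of_nat_mult)
qed

text \<open>The factor \<open>t\<close> need not converge; two-sided bounds suffice. From left to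
  right the slope of exp costs a factor \<open>exp C\<close> and division by \<open>t\<close> a
  factor \<open>1 / c\<close>; from right to left the Lipschitz constant 1 and
  \<open>t n \<le> C\<close> are enough.\<close>

lemma tendsto_exp_diff_iff:
  fixes t q :: "nat \<Rightarrow> real"
  assumes t: "eventually (\<lambda>n. c \<le> t n \<and> t n \<le> C) sequentially" and "0 < c"
    and q: "\<And>n. q n \<in> {0..1}" and th: "0 \<le> \<theta>" "\<theta> \<le> 1"
  shows "(\<lambda>n. exp (- (t n * q n)) - exp (- (t n * \<theta>))) \<longlonglongrightarrow> 0 \<longleftrightarrow> q \<longlonglongrightarrow> \<theta>"
proof
  assume L: "(\<lambda>n. exp (- (t n * q n)) - exp (- (t n * \<theta>))) \<longlonglongrightarrow> 0"
  have "(\<lambda>n. q n - \<theta>) \<longlonglongrightarrow> 0"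
  proof (rule Lim_null_comparison)
    show "eventually (\<lambda>n. norm (q n - \<theta>)
        \<le> exp C / c * \<bar>exp (- (t n * q n)) - exp (- (t n * \<theta>))\<bar>) sequentially"
      using t
    proof eventually_elim
      case (elim n)
      have tn: "0 \<le> t n" using elim \<open>0 < c\<close> by simp
      have "t n * q n \<le> C * 1" "t n * \<theta> \<le> C * 1"
        by (rule mult_mono; use elim q[of n] th tn in simp)+
      then have "exp (- C) * \<bar>- (t n * q n) - - (t n * \<theta>)\<bar>
          \<le> \<bar>exp (- (t n * q n)) - exp (- (t n * \<theta>))\<bar>"
        by (intro abs_exp_diff_ge) auto
      moreover have "\<bar>- (t n * q n) - - (t n * \<theta>)\<bar> = t n * \<bar>q n - \<theta>\<bar>"
        using tn abs_mult[of "t n" "q n - \<theta>"] by (simp add: algebra_simps abs_minus_commute)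
      moreover have "c * \<bar>q n - \<theta>\<bar> \<le> t n * \<bar>q n - \<theta>\<bar>" using elim by (intro mult_right_mono) auto
      ultimately have "exp (- C) * (c * \<bar>q n - \<theta>\<bar>) \<le> \<bar>exp (- (t n * q n)) - exp (- (t n * \<theta>))\<bar>"
        by (smt (verit) exp_gt_zero mult_left_mono)
      then show ?case using \<open>0 < c\<close> by (simp add: exp_minus field_simps)
    qed
    show "(\<lambda>n. exp C / c * \<bar>exp (- (t n * q n)) - exp (- (t n * \<theta>))\<bar>) \<longlonglongrightarrow> 0"
      by (intro tendsto_mult_right_zero tendsto_rabs_zero L)
  qed
  then show "q \<longlonglongrightarrow> \<theta>" by (simp add: LIM_zero_iff)
next
  assume L: "q \<longlonglongrightarrow> \<theta>"
  show "(\<lambda>n. exp (- (t n * q n)) - exp (- (t n * \<theta>))) \<longlonglongrightarrow> 0"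
  proof (rule Lim_null_comparison)
    show "eventually (\<lambda>n. norm (exp (- (t n * q n)) - exp (- (t n * \<theta>)))
        \<le> C * \<bar>q n - \<theta>\<bar>) sequentially"
      using t
    proof eventually_elim
      case (elim n)
      have tn: "0 \<le> t n" using elim \<open>0 < c\<close> by simp
      have "\<bar>exp (- (t n * q n)) - exp (- (t n * \<theta>))\<bar> \<le> \<bar>- (t n * q n) - - (t n * \<theta>)\<bar>"
        using tn q[of n] th by (intro abs_exp_diff_le) auto
      moreover have "\<bar>- (t n * q n) - - (t n * \<theta>)\<bar> = t n * \<bar>q n - \<theta>\<bar>"
        using tn abs_mult[of "t n" "q n - \<theta>"] by (simp add: algebra_simps abs_minus_commute)
      moreover have "t n * \<bar>q n - \<theta>\<bar> \<le> C * \<bar>q n - \<theta>\<bar>" using elim by (intro mult_right_mono) auto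
      ultimately show ?case by simp
    qed
    show "(\<lambda>n. C * \<bar>q n - \<theta>\<bar>) \<longlonglongrightarrow> 0"
      using L by (intro tendsto_mult_right_zero tendsto_rabs_zero) (simp add: LIM_zero_iff)
  qed
qed

text \<open>With the power written as an exponential, the exponents differ by the second-order error
  of ln(1 - a), at most \<open>2 * \<theta> * m n * (a n)\<^sup>2\<close>. As
  \<open>m n * a n\<close> is bounded, this is a multiple of \<open>a n\<close>.\<close>

lemma tendsto_powr_minus_exp:
  fixes a m :: "nat \<Rightarrow> real"
  assumes a: "a \<longlonglongrightarrow> 0" "\<And>n. 0 \<le> a n" and m: "\<And>n. 0 \<le> m n"
    and bd: "eventually (\<lambda>n. m n * a n \<le> C) sequentially" and th: "0 \<le> \<theta>"
  shows "(\<lambda>n. (1 - a n) powr (\<theta> * m n) - exp (- (m n * a n * \<theta>))) \<longlonglongrightarrow> 0"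
proof (rule Lim_null_comparison)
  \<comment> \<open>The bound 1/2 is the range of the logarithm estimate and also keeps the base of
    \<open>powr\<close> positive.\<close>
  have "eventually (\<lambda>n. a n < 1/2) sequentially" using a(1) by (rule order_tendstoD) simp
  with bd show "eventually (\<lambda>n. norm ((1 - a n) powr (\<theta> * m n) - exp (- (m n * a n * \<theta>)))
      \<le> 2 * \<theta> * C * a n) sequentially"
  proof eventually_elim
    case (elim n)
    have "ln (1 - a n) \<le> 0" using elim a(2)[of n] by simp
    then have "\<theta> * m n * ln (1 - a n) \<le> 0"
      using th m[of n] by (simp add: mult_nonneg_nonpos)
    then have "\<bar>exp (\<theta> * m n * ln (1 - a n)) - exp (- (m n * a n * \<theta>))\<bar>
        \<le> \<bar>\<theta> * m n * ln (1 - a n) - - (m n * a n * \<theta>)\<bar>"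
      using th m[of n] a(2)[of n] by (intro abs_exp_diff_le) auto
    also have "\<dots> = \<bar>\<theta> * m n * (ln (1 + - a n) - - a n)\<bar>" by (simp add: algebra_simps)
    also have "\<dots> = \<theta> * m n * \<bar>ln (1 + - a n) - - a n\<bar>"
      using th m[of n] by (simp add: abs_mult)
    also have "\<dots> \<le> \<theta> * m n * (2 * (- a n)\<^sup>2)"
      using th m[of n] elim a(2)[of n]
      by (intro mult_left_mono abs_ln_one_plus_x_minus_x_bound) auto
    also have "\<dots> = 2 * \<theta> * (m n * a n) * a n" by (simp add: power2_eq_square)
    also have "\<dots> \<le> 2 * \<theta> * C * a n"
      using th a(2)[of n] elim by (intro mult_right_mono mult_left_mono) auto
    finally show ?case using elim by (simp add: powr_def)
  qed
  show "(\<lambda>n. 2 * \<theta> * C * a n) \<longlonglongrightarrow> 0" by (intro tendsto_mult_right_zero a)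
qed

section \<open>Volume asymptotics of blocks and of their interiors\<close>

text \<open>Rounding loses less than one block length \<open>k n\<close>, and relative to
  \<open>N n\<close> this is at most the reciprocal of the quotient, which tends to
  infinity.\<close>

lemma tendsto_times_div_ratio:
  fixes N k :: "nat \<Rightarrow> nat"
  assumes "filterlim (\<lambda>n. N n div k n) at_top sequentially"
  shows "(\<lambda>n. real (k n) * real (N n div k n) / real (N n)) \<longlonglongrightarrow> 1"
proof (rule tendsto_sandwich)
  have pos: "eventually (\<lambda>n. 0 < N n div k n) sequentially"
    using assms by (auto simp: filterlim_at_top Suc_le_eq dest: spec[of _ "Suc 0"])
  show "eventually (\<lambda>n. 1 - 1 / real (N n div k n) \<le> real (k n) * real (N n div k n) / real (N n))
      sequentially"
    using pos
  proof eventually_elim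
    case (elim n)
    \<comment> \<open>Division by 0 gives 0 on natural numbers, so a positive quotient forces a
      positive divisor.\<close>
    then have k: "0 < k n" by (metis div_by_0 gr0I less_irrefl)
    have N: "0 < N n" using elim by (metis div_0 gr0I less_irrefl)
    let ?p = "real (N n div k n)"
    have "N n < k n * (N n div k n) + k n"
      using k by (metis add_less_cancel_left mod_less_divisor mult_div_mod_eq)
    then have a: "real (N n) - real (k n) \<le> real (k n) * ?p"
      by (simp flip: of_nat_mult of_nat_add)
    have "k n * (N n div k n) \<le> N n" by simp
    then have "real (k n) * ?p \<le> real (N n)" by (metis of_nat_le_iff of_nat_mult)
    then have "real (k n) / real (N n) \<le> 1 / ?p" using N elim by (simp add: divide_simps)
    moreover have "(real (N n) - real (k n)) / real (N n) \<le> real (k n) * ?p / real (N n)"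
      using a by (intro divide_right_mono) auto
    ultimately show ?case using N by (simp add: diff_divide_distrib)
  qed
  show "eventually (\<lambda>n. real (k n) * real (N n div k n) / real (N n) \<le> 1) sequentially"
  proof (intro always_eventually allI)
    fix n
    have "k n * (N n div k n) \<le> N n" by simp
    then have "real (k n) * real (N n div k n) \<le> real (N n)" by (metis of_nat_le_iff of_nat_mult)
    then show "real (k n) * real (N n div k n) / real (N n) \<le> 1" by (auto simp: divide_le_eq_1)
  qed
  have "filterlim (\<lambda>n. real (N n div k n)) at_top sequentially"
    by (rule filterlim_compose[OF filterlim_real_sequentially assms])
  then have "(\<lambda>n. 1 - 1 / real (N n div k n)) \<longlonglongrightarrow> 1 - 0"
    by (intro tendsto_intros tendsto_divide_0[OF tendsto_const] filterlim_at_top_imp_at_infinity)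
  then show "(\<lambda>n. 1 - 1 / real (N n div k n)) \<longlonglongrightarrow> 1" by simp
qed simp
lemma tendsto_volume_ratio:
  fixes N :: "nat \<Rightarrow> nat ^ 'd::finite" and w :: "nat \<Rightarrow> 'd \<Rightarrow> real"
  assumes vol: "(\<lambda>n. real (\<Prod>l\<in>UNIV. N n $ l)) \<sim>[sequentially] (\<lambda>n. real n ^ CARD('d))"
    and N: "\<And>l. filterlim (\<lambda>n. N n $ l) at_top sequentially"
    and w: "\<And>l. (\<lambda>n. w n l / real (N n $ l)) \<longlonglongrightarrow> 1"
  shows "(\<lambda>n. (\<Prod>l\<in>UNIV. w n l) / real n ^ CARD('d)) \<longlonglongrightarrow> 1"
proof -
  let ?v = "\<lambda>n. real (\<Prod>l\<in>UNIV. N n $ l)"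
  \<comment> \<open>The case distinction comes from asymptotic equivalence, which counts 0/0 as 1;
    it disappears for large \<open>n\<close>.\<close>
  have "(\<lambda>n. if ?v n = 0 \<and> real n ^ CARD('d) = 0 then 1 else ?v n / real n ^ CARD('d)) \<longlonglongrightarrow> 1"
    by (rule asymp_equivD[OF vol])
  then have "(\<lambda>n. (if ?v n = 0 \<and> real n ^ CARD('d) = 0 then 1 else ?v n / real n ^ CARD('d))
      * (\<Prod>l\<in>UNIV. w n l / real (N n $ l))) \<longlonglongrightarrow> 1 * (\<Prod>l\<in>(UNIV :: 'd set). 1)"
    by (intro tendsto_mult tendsto_prod w)
  moreover have "eventually (\<lambda>n. (if ?v n = 0 \<and> real n ^ CARD('d) = 0 then 1 else ?v n / real n ^ CARD('d))
      * (\<Prod>l\<in>UNIV. w n l / real (N n $ l)) = (\<Prod>l\<in>UNIV. w n l) / real n ^ CARD('d)) sequentially"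
  proof -
    have "eventually (\<lambda>n. 0 < N n $ l) sequentially" for l
      using N[of l] by (auto simp: filterlim_at_top Suc_le_eq dest: spec[of _ "Suc 0"])
    then have "eventually (\<lambda>n. \<forall>l. 0 < N n $ l) sequentially" by (rule eventually_all_finite)
    then show ?thesis using eventually_gt_at_top[of 0]
    proof eventually_elim
      case (elim n)
      then have "?v n \<noteq> 0" by (metis less_irrefl of_nat_eq_0_iff prod_zero_iff finite)
      then show ?case using elim by (simp add: prod_dividef)
    qed
  qed
  ultimately show ?thesis by (simp add: tendsto_cong)
qed

text \<open>Removing two boundary layers of width \<open>N n div k n\<close> from a side of length
  \<open>N n div k' n\<close> costs, relative to that side, about \<open>2 * k' n / k n\<close>,
  which vanishes.\<close>

lemma tendsto_interior_ratio:
  fixes N k k' :: "nat \<Rightarrow> nat"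
  assumes "filterlim (\<lambda>n. N n div k' n) at_top sequentially"
    and "\<And>n. 0 < k n" and "(\<lambda>n. real (k' n) / real (k n)) \<longlonglongrightarrow> 0"
  shows "(\<lambda>n. real (k' n) * real (N n div k' n - 2 * (N n div k n)) / real (N n)) \<longlonglongrightarrow> 1"
proof (rule tendsto_sandwich)
  show "eventually (\<lambda>n. real (k' n) * real (N n div k' n) / real (N n) - 2 * (real (k' n) / real (k n))
      \<le> real (k' n) * real (N n div k' n - 2 * (N n div k n)) / real (N n)) sequentially"
  proof (intro always_eventually allI)
    fix n
    let ?p = "real (N n div k n)" and ?p' = "real (N n div k' n)"
    have "?p \<le> real (N n) / real (k n)" by (rule of_nat_div_le_of_nat)
    then have "?p / real (N n) \<le> 1 / real (k n)"
      using assms(2)[of n] by (cases "N n = 0") (simp_all add: divide_simps)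
    then have a: "real (k' n) * (?p / real (N n)) \<le> real (k' n) * (1 / real (k n))"
      by (rule mult_left_mono) simp
    have "?p' - 2 * ?p \<le> real (N n div k' n - 2 * (N n div k n))" by linarith
    then have "real (k' n) * (?p' - 2 * ?p) / real (N n)
        \<le> real (k' n) * real (N n div k' n - 2 * (N n div k n)) / real (N n)"
      by (intro divide_right_mono mult_left_mono) auto
    then show "real (k' n) * ?p' / real (N n) - 2 * (real (k' n) / real (k n))
      \<le> real (k' n) * real (N n div k' n - 2 * (N n div k n)) / real (N n)"
      using a by (simp add: right_diff_distrib diff_divide_distrib)
  qed
  show "eventually (\<lambda>n. real (k' n) * real (N n div k' n - 2 * (N n div k n)) / real (N n)
      \<le> real (k' n) * real (N n div k' n) / real (N n)) sequentially"
    by (intro always_eventually allI divide_right_mono mult_left_mono) auto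
  have L: "(\<lambda>n. real (k' n) * real (N n div k' n) / real (N n)) \<longlonglongrightarrow> 1"
    by (rule tendsto_times_div_ratio) fact
  have "(\<lambda>n. real (k' n) * real (N n div k' n) / real (N n) - 2 * (real (k' n) / real (k n)))
      \<longlonglongrightarrow> 1 - 2 * 0"
    by (intro tendsto_intros L assms(3))
  then show "(\<lambda>n. real (k' n) * real (N n div k' n) / real (N n) - 2 * (real (k' n) / real (k n)))
      \<longlonglongrightarrow> 1" by simp
  show "(\<lambda>n. real (k' n) * real (N n div k' n) / real (N n)) \<longlonglongrightarrow> 1" by (rule L)
qed

section \<open>A slower admissible sequence and the exponential limit\<close>

lemma filterlim_floor_sqrt:
  assumes "filterlim k at_top F"
  shows "filterlim (\<lambda>n. floor_sqrt (k n)) at_top F"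
  using assms unfolding filterlim_at_top le_floor_sqrt_iff by blast

lemma tendsto_floor_sqrt_ratio:
  assumes "filterlim k at_top sequentially"
  shows "(\<lambda>n. real (floor_sqrt (k n)) / real (k n)) \<longlonglongrightarrow> 0"
proof (rule tendsto_sandwich)
  show "eventually (\<lambda>n. 0 \<le> real (floor_sqrt (k n)) / real (k n)) sequentially" by simp
  show "eventually (\<lambda>n. real (floor_sqrt (k n)) / real (k n) \<le> 1 / real (floor_sqrt (k n))) sequentially"
  proof (intro always_eventually allI)
    fix n
    have "floor_sqrt (k n) * floor_sqrt (k n) \<le> k n"
      using floor_sqrt_power2_le[of "k n"] by (simp add: power2_eq_square)
    then have "real (floor_sqrt (k n)) * real (floor_sqrt (k n)) \<le> real (k n)"
      by (metis of_nat_le_iff of_nat_mult)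
    then show "real (floor_sqrt (k n)) / real (k n) \<le> 1 / real (floor_sqrt (k n))"
      by (cases "k n = 0") (simp_all add: field_simps)
  qed
  have "filterlim (\<lambda>n. real (floor_sqrt (k n))) at_top sequentially"
    by (rule filterlim_compose[OF filterlim_real_sequentially filterlim_floor_sqrt[OF assms]])
  then show "(\<lambda>n. 1 / real (floor_sqrt (k n))) \<longlonglongrightarrow> 0"
    by (intro tendsto_divide_0[OF tendsto_const] filterlim_at_top_imp_at_infinity)
qed simp

text \<open>Decreasing \<open>k\<close> preserves smallness relative to \<open>r\<close> and only
  enlarges the blocks, so the one property at risk is divergence, which the square root
  keeps.\<close>

lemma admissible_floor_sqrt:
  assumes "admissible N r k"
  shows "admissible N r (\<lambda>n. floor_sqrt (k n))"
  unfolding admissible_def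
proof (intro conjI allI)
  have k: "\<And>n. 0 < k n" "filterlim k at_top sequentially"
    "(\<lambda>n. real (k n)) \<in> o[sequentially](r)"
    "\<And>l. filterlim (\<lambda>n. block_size N k n $ l) at_top sequentially"
    using assms by (auto simp: admissible_def)
  show "0 < floor_sqrt (k n)" for n using k(1) by simp
  show "filterlim (\<lambda>n. floor_sqrt (k n)) at_top sequentially" by (rule filterlim_floor_sqrt[OF k(2)])
  show "(\<lambda>n. real (floor_sqrt (k n))) \<in> o[sequentially](r)"
    by (rule landau_o.big_small_trans[OF _ k(3)])
       (auto intro!: landau_o.big_mono always_eventually simp: floor_sqrt_le)
  show "filterlim (\<lambda>n. block_size N (\<lambda>n. floor_sqrt (k n)) n $ l) at_top sequentially" for l
    by (rule filterlim_at_top_mono[OF k(4)[of l]])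
       (auto intro!: always_eventually div_le_mono2 simp: block_size_def floor_sqrt_le k(1))
qed

text \<open>The last-exceedance decomposition on blocks \<open>p(n)\<close> bounds the exceedance probability from
  below; on the much larger blocks belonging to \<open>\<lfloor>\<surd>k\<^sub>n\<rfloor>\<close>, whose boundary layer of width
  \<open>p(n)\<close> is negligible, it gives the matching upper bound.\<close>

lemma tendsto_max_prob_minus_exp:
  fixes X :: "int ^ 'd::finite \<Rightarrow> 'a \<Rightarrow> real" and N :: "nat \<Rightarrow> nat ^ 'd"
  assumes ps: "prob_space M" and meas: "\<And>i. X i \<in> borel_measurable M"
    and stat: "stationary_field M X" and ord: "transl_inv_total_order R"
    and N: "\<And>l. filterlim (\<lambda>n. N n $ l) at_top sequentially"
    and vol: "(\<lambda>n. real (\<Prod>l\<in>UNIV. N n $ l)) \<sim>[sequentially] (\<lambda>n. real n ^ CARD('d))"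
    and factor: "\<And>k'. admissible N r k' \<Longrightarrow>
           (\<lambda>n. \<P>(\<omega> in M. field_max X (lattice_box (N n)) \<omega> \<le> v n)
              - \<P>(\<omega> in M. field_max X (lattice_box (block_size N k' n)) \<omega> \<le> v n)
                  ^ (k' n ^ CARD('d))) \<longlonglongrightarrow> 0"
    and bound: "eventually (\<lambda>n. real n ^ CARD('d) * \<P>(\<omega> in M. X 0 \<omega> > v n) \<le> C) sequentially"
    and adm: "admissible N r k"
  shows "(\<lambda>n. \<P>(\<omega> in M. field_max X (lattice_box (N n)) \<omega> \<le> v n)
     - exp (- (real n ^ CARD('d) * \<P>(\<omega> in M. X 0 \<omega> > v n)
         * \<P>(\<omega> in M. field_max X (pos_box R (block_size N k n)) \<omega> \<le> v n \<bar> X 0 \<omega> > v n))))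
     \<longlonglongrightarrow> 0"
proof -
  interpret prob_space M by fact
  let ?D = "CARD('d)"
  define u where "u n = \<P>(\<omega> in M. field_max X (lattice_box (N n)) \<omega> \<le> v n)" for n
  define a where "a n = \<P>(\<omega> in M. X 0 \<omega> > v n)" for n
  define t where "t n = real n ^ ?D * a n" for n
  define q where
    "q n = \<P>(\<omega> in M. field_max X (pos_box R (block_size N k n)) \<omega> \<le> v n \<bar> X 0 \<omega> > v n)" for n
  define e where
    "e k' n = \<P>(\<omega> in M. \<exists>i\<in>lattice_box (block_size N k' n). X i \<omega> > v n)" for k' n
  define V where "V k' n = real (\<Prod>l\<in>UNIV. block_size N k' n $ l)" for k' n
  \<comment> \<open>Volume covered by all blocks relative to \<open>n^d\<close>. It tends to 1 and
    converts block counts times volumes into multiples of \<open>t\<close>.\<close>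
  define W where "W k' n = real (k' n) ^ ?D * V k' n / real n ^ ?D" for k' n
  have a0: "0 \<le> a n" for n by (simp add: a_def)
  have t0: "0 \<le> t n" for n by (simp add: t_def a0)
  have e01: "0 \<le> e k' n" "e k' n \<le> 1" for k' n by (simp_all add: e_def)
  have q01: "0 \<le> q n" "q n \<le> 1" for n
    using cond_prob_times_exceed(2)[OF ps meas stat ord finite_pos_box] by (simp_all add: q_def)
  have aq: "a n * q n = \<P>(\<omega> in M. X 0 \<omega> > v n \<and> (\<forall>j\<in>pos_box R (block_size N k n). X j \<omega> \<le> v n))" for n
    unfolding a_def q_def by (rule cond_prob_times_exceed(1)[OF ps meas stat ord finite_pos_box])
  have bd: "eventually (\<lambda>n. t n \<le> C \<and> 0 < n) sequentially"
    using bound eventually_gt_at_top[of 0] by eventually_elim (simp add: t_def a_def)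
  have W: "W k' \<longlonglongrightarrow> 1" if "admissible N r k'" for k'
  proof -
    have "(\<lambda>n. (\<Prod>l\<in>UNIV. real (k' n) * real (block_size N k' n $ l)) / real n ^ ?D) \<longlonglongrightarrow> 1"
      using that tendsto_times_div_ratio
      by (intro tendsto_volume_ratio[OF vol N]) (simp add: admissible_def block_size_def)
    then show ?thesis by (simp add: W_def[abs_def] V_def prod.distrib)
  qed
  have Wa: "real (k' n) ^ ?D * (V k' n * a n) = W k' n * t n" if "0 < n" for k' n
    using that by (simp add: W_def t_def)
  have u_exp: "(\<lambda>n. u n - exp (- (real (k' n) ^ ?D * e k' n))) \<longlonglongrightarrow> 0" if k': "admissible N r k'" for k'
  proof -
    have "filterlim (\<lambda>n. real (k' n)) at_top sequentially"
      using k' by (auto simp: admissible_def intro: filterlim_compose[OF filterlim_real_sequentially])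
    \<comment> \<open>Origin of the bound: eventually \<open>W k' n < 2\<close> and
      \<open>t n \<le> C\<close>, so K e is at most \<open>2 * C\<close> for K = k'^d. Hence K e^2 =
      (K e)^2 / K, and K is at least \<open>k' n\<close> because d >= 1.\<close>
    then have inv0: "(\<lambda>n. (2 * C)\<^sup>2 / real (k' n)) \<longlonglongrightarrow> 0"
      by (intro tendsto_divide_0[OF tendsto_const] filterlim_at_top_imp_at_infinity)
    have "(\<lambda>n. (1 - e k' n) ^ (k' n ^ ?D) - exp (- (real (k' n ^ ?D) * e k' n))) \<longlonglongrightarrow> 0"
    proof (rule Lim_null_comparison[OF _ inv0])
      have "eventually (\<lambda>n. W k' n < 2) sequentially"
        using W[OF k'] by (rule order_tendstoD) simp
      then show "eventually (\<lambda>n. norm ((1 - e k' n) ^ (k' n ^ ?D) - exp (- (real (k' n ^ ?D) * e k' n)))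
          \<le> (2 * C)\<^sup>2 / real (k' n)) sequentially"
        using bd
      proof eventually_elim
        case (elim n)
        let ?K = "real (k' n ^ ?D)"
        have kpos: "0 < k' n" using k' by (simp add: admissible_def)
        have K: "real (k' n) \<le> ?K" using kpos by (simp add: self_le_power)
        have "?K * e k' n \<le> ?K * (V k' n * a n)"
          unfolding e_def V_def a_def
          by (intro mult_left_mono prob_exceedance_le_card[OF ps meas stat ord]) simp
        also have "\<dots> = W k' n * t n" using Wa elim by simp
        also have "\<dots> \<le> 2 * C" using elim t0[of n] by (intro mult_mono) auto
        finally have Ke: "?K * e k' n \<le> 2 * C" .
        have "real (k' n) * (?K * (e k' n)\<^sup>2) \<le> ?K * (?K * (e k' n)\<^sup>2)"
          using K by (rule mult_right_mono) simp
        also have "\<dots> = (?K * e k' n)\<^sup>2" by (simp add: power2_eq_square)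
        also have "\<dots> \<le> (2 * C)\<^sup>2" using Ke e01(1)[of k' n] by (intro power_mono) auto
        finally have "?K * (e k' n)\<^sup>2 \<le> (2 * C)\<^sup>2 / real (k' n)"
          using kpos by (simp add: field_simps)
        then show ?case
          using abs_power_minus_exp_le[OF e01[of k' n], of "k' n ^ ?D"] by simp
      qed
    qed
    moreover have "(\<lambda>n. u n - (1 - e k' n) ^ (k' n ^ ?D)) \<longlonglongrightarrow> 0"
      using factor[OF k']
      unfolding prob_field_max_le_eq[OF ps meas stat ord finite_lattice_box] u_def e_def .
    ultimately show ?thesis using tendsto_add by fastforce
  qed
  define k' where "k' n = floor_sqrt (k n)" for n
  have adm': "admissible N r k'"
    using admissible_floor_sqrt[OF adm] by (simp add: k'_def[abs_def])
  define V' where "V' n = real (\<Prod>l\<in>UNIV. block_size N k' n $ l - 2 * block_size N k n $ l)" for n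
  define W' where "W' n = real (k' n) ^ ?D * V' n / real n ^ ?D" for n
  have W': "W' \<longlonglongrightarrow> 1"
  proof -
    have "(\<lambda>n. (\<Prod>l\<in>UNIV. real (k' n) * real (block_size N k' n $ l - 2 * block_size N k n $ l))
        / real n ^ ?D) \<longlonglongrightarrow> 1"
    proof (rule tendsto_volume_ratio[OF vol N])
      fix l
      have "(\<lambda>n. real (k' n) / real (k n)) \<longlonglongrightarrow> 0"
        unfolding k'_def using adm by (intro tendsto_floor_sqrt_ratio) (simp add: admissible_def)
      then show "(\<lambda>n. real (k' n) * real (block_size N k' n $ l - 2 * block_size N k n $ l)
          / real (N n $ l)) \<longlonglongrightarrow> 1"
        using adm adm' unfolding admissible_def block_size_def
        by (simp add: tendsto_interior_ratio)
    qed
    then show ?thesis by (simp add: W'_def[abs_def] V'_def prod.distrib)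
  qed
  have "(\<lambda>n. u n - exp (- (t n * q n))) \<longlonglongrightarrow> 0"
  proof (rule tendsto_sandwich)
    \<comment> \<open>An upper bound on the exceedance probability bounds \<open>u\<close> from
      below, so this half uses the large blocks of \<open>k'\<close> while \<open>q\<close> keeps
      the window of \<open>k\<close>.\<close>
    show "eventually (\<lambda>n. (u n - exp (- (real (k' n) ^ ?D * e k' n)))
        - (\<bar>W k' n - 1\<bar> + \<bar>W k' n - W' n\<bar>) * C \<le> u n - exp (- (t n * q n))) sequentially"
      using bd
    proof eventually_elim
      case (elim n)
      \<comment> \<open>This is k'^d times the bound of \<open>prob_exceedance_le\<close>. The first
        summand is the desired exponent up to a factor tending to 1; the second is the boundary
        layer, small since \<open>W k'\<close> and \<open>W'\<close> have the same limit.\<close>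
      define z where "z = W k' n * t n * q n + (W k' n - W' n) * t n"
      have pos: "0 < k' n" using adm' by (simp add: admissible_def)
      have le: "block_size N k n $ l \<le> block_size N k' n $ l" for l
        using pos by (simp add: block_size_def k'_def div_le_mono2 floor_sqrt_le)
      have "real (k' n) ^ ?D * e k' n
          \<le> real (k' n) ^ ?D * (V k' n * (a n * q n) + (V k' n - V' n) * a n)"
        unfolding aq unfolding V_def V'_def e_def a_def
        by (intro mult_left_mono prob_exceedance_le[OF ps meas stat ord] le) simp
      also have "\<dots> = z"
        using elim by (simp add: z_def W_def W'_def t_def field_simps)
      finally have ez: "real (k' n) ^ ?D * e k' n \<le> z" .
      then have z0: "0 \<le> z" using e01(1)[of k' n] by (smt (verit) mult_nonneg_nonneg of_nat_0_le_iff zero_le_power)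
      have "exp (- (t n * q n)) - exp (- (real (k' n) ^ ?D * e k' n)) \<le> exp (- (t n * q n)) - exp (- z)"
        using ez by simp
      also have "\<dots> \<le> \<bar>- (t n * q n) - - z\<bar>"
        by (rule order_trans[OF abs_ge_self abs_exp_diff_le]) (simp_all add: z0 t0 q01)
      also have "- (t n * q n) - - z = (W k' n - 1) * (t n * q n) + (W k' n - W' n) * t n"
        by (simp add: z_def algebra_simps)
      also have "\<bar>\<dots>\<bar> \<le> \<bar>W k' n - 1\<bar> * (t n * q n) + \<bar>W k' n - W' n\<bar> * t n"
        by (rule order_trans[OF abs_triangle_ineq]) (simp add: abs_mult t0 q01)
      also have "\<dots> \<le> \<bar>W k' n - 1\<bar> * (C * 1) + \<bar>W k' n - W' n\<bar> * C"
        using elim by (intro add_mono mult_left_mono mult_mono) (auto simp: q01 intro: order_trans[OF t0])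
      finally show ?case by (simp add: algebra_simps)
    qed
    \<comment> \<open>Here blocks and window both belong to \<open>k\<close>, and rounding of the
      volume is the only error besides the one in \<open>u_exp\<close>.\<close>
    show "eventually (\<lambda>n. u n - exp (- (t n * q n))
        \<le> (u n - exp (- (real (k n) ^ ?D * e k n))) + \<bar>W k n - 1\<bar> * C) sequentially"
      using bd
    proof eventually_elim
      case (elim n)
      have W0: "0 \<le> W k n" by (simp add: W_def V_def prod_nonneg)
      have "real (k n) ^ ?D * (V k n * (a n * q n)) \<le> real (k n) ^ ?D * e k n"
        unfolding aq V_def e_def
        by (intro mult_left_mono prob_exceedance_ge[OF ps meas stat ord]) simp
      then have "W k n * t n * q n \<le> real (k n) ^ ?D * e k n"
        using Wa[of n k] elim by (simp add: mult.assoc[symmetric])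
      then have "exp (- (real (k n) ^ ?D * e k n)) \<le> exp (- (W k n * t n * q n))" by simp
      also have "\<dots> - exp (- (t n * q n)) \<le> \<bar>- (W k n * t n * q n) - - (t n * q n)\<bar>"
        by (rule order_trans[OF abs_ge_self abs_exp_diff_le]) (simp_all add: W0 t0 q01)
      also have "\<dots> = \<bar>(W k n - 1) * (t n * q n)\<bar>" by (simp add: algebra_simps abs_minus_commute)
      also have "\<dots> = \<bar>W k n - 1\<bar> * (t n * q n)" by (simp add: abs_mult t0 q01)
      also have "\<dots> \<le> \<bar>W k n - 1\<bar> * (C * 1)"
        using elim by (intro mult_left_mono mult_mono) (auto simp: q01 intro: order_trans[OF t0])
      finally show ?case by simp
    qed
    have "(\<lambda>n. (u n - exp (- (real (k' n) ^ ?D * e k' n))) - (\<bar>W k' n - 1\<bar> + \<bar>W k' n - W' n\<bar>) * C)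
        \<longlonglongrightarrow> 0 - (\<bar>1 - 1\<bar> + \<bar>1 - 1\<bar>) * C"
      by (intro tendsto_intros W W' u_exp adm')
    then show "(\<lambda>n. (u n - exp (- (real (k' n) ^ ?D * e k' n)))
        - (\<bar>W k' n - 1\<bar> + \<bar>W k' n - W' n\<bar>) * C) \<longlonglongrightarrow> 0" by simp
    have "(\<lambda>n. (u n - exp (- (real (k n) ^ ?D * e k n))) + \<bar>W k n - 1\<bar> * C) \<longlonglongrightarrow> 0 + \<bar>1 - 1\<bar> * C"
      by (intro tendsto_intros W u_exp adm)
    then show "(\<lambda>n. (u n - exp (- (real (k n) ^ ?D * e k n))) + \<bar>W k n - 1\<bar> * C) \<longlonglongrightarrow> 0" by simp
  qed
  then show ?thesis by (simp add: u_def t_def a_def q_def)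
qed

section \<open>The equivalent characterizations of \<open>\<theta>\<close>\<close>

theorem mainTheorem3:
  fixes M :: "'a measure"
    and X :: "int ^ 'd::finite \<Rightarrow> 'a \<Rightarrow> real"
    and R :: "((int ^ 'd) \<times> (int ^ 'd)) set"
    and v r :: "nat \<Rightarrow> real"
    and N :: "nat \<Rightarrow> nat ^ 'd"
    and k :: "nat \<Rightarrow> nat"
    and \<theta> :: real
  assumes "prob_space M"
    and "\<And>i. X i \<in> borel_measurable M"
    and "stationary_field M X"
    and "transl_inv_total_order R"
    and "\<And>l. filterlim (\<lambda>n. N n $ l) at_top sequentially"
    and "(\<lambda>n. real (\<Prod>l\<in>UNIV. N n $ l)) \<sim>[sequentially] (\<lambda>n. real n ^ CARD('d))"
    and "filterlim r at_top sequentially"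
    and "\<And>k'. admissible N r k' \<Longrightarrow>
           (\<lambda>n. \<P>(\<omega> in M. field_max X (lattice_box (N n)) \<omega> \<le> v n)
              - \<P>(\<omega> in M. field_max X (lattice_box (block_size N k' n)) \<omega> \<le> v n)
                  ^ (k' n ^ CARD('d))) \<longlonglongrightarrow> 0"
    and "0 < liminf (\<lambda>n. ereal (\<P>(\<omega> in M. field_max X (lattice_box (N n)) \<omega> \<le> v n)))"
    and "0 < liminf (\<lambda>n. ereal (real n ^ CARD('d) * \<P>(\<omega> in M. X 0 \<omega> > v n)))"
    and "limsup (\<lambda>n. ereal (real n ^ CARD('d) * \<P>(\<omega> in M. X 0 \<omega> > v n))) < \<infinity>"
    and "admissible N r k"
    and "0 \<le> \<theta>" and "\<theta> \<le> 1"
  defines "C1 \<equiv> (\<lambda>n. \<P>(\<omega> in M. field_max X (lattice_box (N n)) \<omega> \<le> v n)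
                    - \<P>(\<omega> in M. X 0 \<omega> \<le> v n) powr (\<theta> * real n ^ CARD('d))) \<longlonglongrightarrow> 0"
    and "C2 \<equiv> (\<lambda>n. \<P>(\<omega> in M. field_max X (pos_box R (block_size N k n)) \<omega> \<le> v n
                        \<bar> X 0 \<omega> > v n)) \<longlonglongrightarrow> \<theta>"
    and "C3 \<equiv> (\<lambda>m. (\<lambda>n. \<P>(\<omega> in M. field_max X (pos_box R (\<chi> l. m)) \<omega> \<le> v n
                        \<bar> X 0 \<omega> > v n)) \<longlonglongrightarrow> \<theta>)"
  shows "(C1 \<longleftrightarrow> C2) \<and>
    (\<forall>m::nat.
      (\<lambda>n. real n ^ CARD('d) *
         \<P>(\<omega> in M. X 0 \<omega> > v n \<and> v n \<ge> field_max X (pos_box R (\<chi> l. m)) \<omega> \<and>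
            field_max X (pos_box R (block_size N k n) - pos_box R (\<chi> l. m)) \<omega> > v n)) \<longlonglongrightarrow> 0
      \<longrightarrow> (C1 \<longleftrightarrow> C3 m) \<and> (C2 \<longleftrightarrow> C3 m))"
proof -
  interpret prob_space M by fact
  note fld = assms(1-4) and fin = finite_pos_box
  let ?A = "\<lambda>n. pos_box R (block_size N k n)"
  define u where "u n = \<P>(\<omega> in M. field_max X (lattice_box (N n)) \<omega> \<le> v n)" for n
  define a where "a n = \<P>(\<omega> in M. X 0 \<omega> > v n)" for n
  define t where "t n = real n ^ CARD('d) * a n" for n
  define cp where "cp A n = \<P>(\<omega> in M. field_max X A \<omega> \<le> v n \<bar> X 0 \<omega> > v n)" for A n
  define q where "q n = cp (?A n) n" for n
  have a0: "0 \<le> a n" for n by (simp add: a_def)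
  have cp01: "cp A n \<in> {0..1}" if "finite A" for A n
    unfolding cp_def by (rule cond_prob_times_exceed(2)[OF fld that])
  obtain c where c: "0 < c" "ereal c < liminf (\<lambda>n. ereal (t n))"
    using ereal_dense2[OF assms(10)] by (auto simp: t_def a_def)
  obtain C where C: "limsup (\<lambda>n. ereal (t n)) < ereal C"
    using ereal_dense2[OF assms(11)] by (auto simp: t_def a_def)
  have tb: "eventually (\<lambda>n. c \<le> t n \<and> t n \<le> C) sequentially"
    using less_LiminfD[OF c(2)] Limsup_lessD[OF C] by eventually_elim simp
  have a_lim: "a \<longlonglongrightarrow> 0"
  proof (rule Lim_null_comparison)
    show "(\<lambda>n. C / real n) \<longlonglongrightarrow> 0" by (rule lim_const_over_n)
    show "eventually (\<lambda>n. norm (a n) \<le> C / real n) sequentially"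
      using tb eventually_gt_at_top[of 0]
    proof eventually_elim
      case (elim n)
      \<comment> \<open>Since d >= 1, boundedness of \<open>t\<close> already forces
        \<open>a n\<close> to be of order 1/n, as the logarithm expansion in \<open>p_exp\<close>
        requires.\<close>
      have "real n * a n \<le> real n ^ CARD('d) * a n"
        using elim a0 by (intro mult_right_mono) (simp_all add: self_le_power)
      then show ?case using elim a0[of n] by (simp add: t_def field_simps)
    qed
  qed
  have u_q: "(\<lambda>n. u n - exp (- (t n * q n))) \<longlonglongrightarrow> 0"
    unfolding u_def t_def a_def q_def cp_def
    by (rule tendsto_max_prob_minus_exp[OF assms(1-6,8) _ assms(12)])
       (use tb in \<open>auto simp: t_def a_def elim: eventually_mono\<close>)
  have p_exp: "(\<lambda>n. \<P>(\<omega> in M. X 0 \<omega> \<le> v n) powr (\<theta> * real n ^ CARD('d)) - exp (- (t n * \<theta>)))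
      \<longlonglongrightarrow> 0"
    unfolding prob_below_eq[OF fld] t_def a_def[symmetric]
    by (rule tendsto_powr_minus_exp[OF a_lim a0, of _ C])
       (use tb assms(13) in \<open>auto simp: t_def elim: eventually_mono\<close>)
  have C1: "C1 \<longleftrightarrow> (\<lambda>n. exp (- (t n * q n)) - exp (- (t n * \<theta>))) \<longlonglongrightarrow> 0" (is "_ \<longleftrightarrow> ?E")
  proof
    assume C1
    from tendsto_add[OF tendsto_diff[OF this[unfolded C1_def] u_q] p_exp]
    show ?E by (simp add: u_def)
  next
    assume ?E
    from tendsto_diff[OF tendsto_add[OF this u_q] p_exp]
    show C1 by (simp add: C1_def u_def)
  qed
  \<comment> \<open>With \<open>u_q\<close> and \<open>p_exp\<close> both probabilities in
    \<open>C1\<close> have become exponentials with the common factor \<open>t\<close>, so only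
    \<open>q\<close> and \<open>\<theta>\<close> remain to be compared.\<close>
  have C2: "C2 \<longleftrightarrow> q \<longlonglongrightarrow> \<theta>" by (simp add: C2_def q_def[abs_def] cp_def)
  have C12: "C1 \<longleftrightarrow> C2"
    unfolding C1 C2
    by (rule tendsto_exp_diff_iff[OF tb c(1)]) (use cp01[OF fin] assms(13,14) in \<open>auto simp: q_def\<close>)
  moreover have "C2 \<longleftrightarrow> C3 m"
    if H: "(\<lambda>n. real n ^ CARD('d) *
         \<P>(\<omega> in M. X 0 \<omega> > v n \<and> v n \<ge> field_max X (pos_box R (\<chi> l. m)) \<omega> \<and>
            field_max X (?A n - pos_box R (\<chi> l. m)) \<omega> > v n)) \<longlonglongrightarrow> 0" (is "?d \<longlonglongrightarrow> 0")
    for m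
  proof -
    let ?B = "pos_box R (\<chi> l. m)"
    have "eventually (\<lambda>n. \<forall>l. m \<le> block_size N k n $ l) sequentially"
      using assms(12) by (intro eventually_all_finite) (auto simp: admissible_def filterlim_at_top)
    \<comment> \<open>Every coordinate of \<open>p(n)\<close> eventually exceeds \<open>m\<close>,
      so the fixed window is nested in the growing one, as \<open>prob_below_diff\<close>
      needs.\<close>
    then have sub: "eventually (\<lambda>n. ?B \<subseteq> ?A n) sequentially"
    proof eventually_elim
      case (elim n)
      then have m: "int m \<le> int (block_size N k n $ l)" for l by simp
      have "- int (block_size N k n $ l) \<le> j $ l \<and> j $ l \<le> int (block_size N k n $ l)"
        if "- int m \<le> j $ l \<and> j $ l \<le> int m" for j :: "int ^ 'd" and l
        using that m[of l] by linarith
      then show ?case by (auto simp: pos_box_def)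
    qed
    have "(\<lambda>n. cp ?B n - q n) \<longlonglongrightarrow> 0"
    proof (rule Lim_null_comparison)
      show "(\<lambda>n. \<bar>?d n\<bar> / c) \<longlonglongrightarrow> 0" by (intro tendsto_divide_zero tendsto_rabs_zero H)
      show "eventually (\<lambda>n. norm (cp ?B n - q n) \<le> \<bar>?d n\<bar> / c) sequentially"
        using sub tb
      proof eventually_elim
        case (elim n)
        \<comment> \<open>The additional condition is exactly \<open>t n\<close> times the
          difference of the two conditional probabilities; the lower bound \<open>c\<close> on
          \<open>t\<close> then makes this difference vanish.\<close>
        have "?d n = real n ^ CARD('d) * (a n * cp ?B n - a n * q n)"
          unfolding a_def q_def cp_def cond_prob_times_exceed(1)[OF fld fin]
          using prob_below_diff[OF fld fin fin elim(1)] by simp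
        then have "?d n = t n * (cp ?B n - q n)"
          by (simp only: t_def right_diff_distrib mult.assoc)
        then have "\<bar>?d n\<bar> = t n * \<bar>cp ?B n - q n\<bar>" using elim c(1) by (simp only: abs_mult) simp
        moreover have "c * \<bar>cp ?B n - q n\<bar> \<le> t n * \<bar>cp ?B n - q n\<bar>"
          using elim by (intro mult_right_mono) auto
        ultimately have "\<bar>cp ?B n - q n\<bar> * c \<le> \<bar>?d n\<bar>" by (simp only: mult.commute)
        then show ?case using c(1) by (simp only: pos_le_divide_eq real_norm_def)
      qed
    qed
    then have "q \<longlonglongrightarrow> \<theta> \<longleftrightarrow> cp ?B \<longlonglongrightarrow> \<theta>"
      by (metis Lim_transform Lim_transform2)
    then show ?thesis unfolding C2 by (simp add: C3_def cp_def[abs_def])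
  qed
  ultimately show ?thesis by blast
qed

end
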